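(* Let $\mathcal{R}$ be a $2$-torsion free unital ring, let $n\geq 2$, and let $M_n(\mathcal{R})$ be the ring of all $n\times n$ matrices over $\mathcal{R}$. Then every Jordan derivation from the trivial extension $T(M_n(\mathcal{R}),M_n(\mathcal{R}))$ into itself is a derivation.
   Context: All rings are associative (not necessarily commutative). A ring is $2$-torsion free if $2x=0$ implies $x=0$ for every element $x$. Given a ring $\mathcal{A}$ and an $\mathcal{A}$-bimodule $\mathcal{M}$, the trivial extension of $\mathcal{A}$ by $\mathcal{M}$ is the ring $T(\mathcal{A},\mathcal{M})=\mathcal{A}\oplus\mathcal{M}$ with the usual (componentwise) addition and the multiplication $(a_1,m_1)(a_2,m_2)=(a_1a_2,\,a_1m_2+m_1a_2)$; here $\mathcal{M}=\mathcal{A}$ with its natural bimodule structure. For a ring $\mathcal{T}$, an additive map $\Delta:\mathcal{T}\rightarrow\mathcal{T}$ is a Jordan derivation if $\Delta(xy+yx)=\Delta(x)y+x\Delta(y)+\Delta(y)x+y\Delta(x)$ for all $x,y\in\mathcal{T}$, and a derivation if $\Delta(xy)=\Delta(x)y+x\Delta(y)$ for all $x,y\in\mathcal{T}$. *)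

theory Defs
  imports "Jordan_Normal_Form.Matrix"
begin

text \<open>The sort \<open>{ring, monoid_mult}\<close> is that of associative unital rings, not necessarily
  commutative. Unlike \<open>ring_1\<close> it does not demand \<open>0 \<noteq> 1\<close>, so it also covers the zero ring.
  The library's \<open>ring_mat\<close> is restricted to \<open>semiring_1\<close>, hence to \<open>0 \<noteq> 1\<close>; the
  following record has the same components over the larger sort.\<close>

definition matrix_ring :: "'a :: {ring, monoid_mult} itself \<Rightarrow> nat \<Rightarrow> 'a mat ring" where
  "matrix_ring ty n =
    \<lparr> carrier = carrier_mat n n, mult = (*), one = 1\<^sub>m n, zero = 0\<^sub>m n n, add = (+) \<rparr>"

lemma matrix_ring_eq_ring_mat:
  "matrix_ring TYPE('a :: ring_1) n = ring_mat TYPE('a) n ()"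
  by (simp add: matrix_ring_def ring_mat_def)

lemma ring_matrix_ring: "ring (matrix_ring TYPE('a :: {ring, monoid_mult}) n)"
proof -
  have scalar_unit:
    "row (1\<^sub>m n) i \<bullet> v = v $ i" "v \<bullet> col (1\<^sub>m n) i = v $ i"
    if "v \<in> carrier_vec n" "i < n" for v :: "'a vec" and i
    using that
    by (auto simp: scalar_prod_def one_mat_def row_def col_def if_distrib if_distribR
        sum.delta sum.delta' cong: if_cong)
  have one: "1\<^sub>m n * A = A" "A * 1\<^sub>m n = A" if "A \<in> carrier_mat n n" for A :: "'a mat"
    using that by (auto intro!: eq_matI simp: times_mat_def scalar_unit)
  have "\<exists>B \<in> carrier_mat n n. B + A = 0\<^sub>m n n \<and> A + B = 0\<^sub>m n n"
    if "A \<in> carrier_mat n n" for A :: "'a mat"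
    using that by (intro bexI[of _ "- A"]) auto
  then show ?thesis
    by unfold_locales
      (auto simp: matrix_ring_def Units_def one add_mult_distrib_mat mult_add_distrib_mat
        comm_add_mat)
qed


text \<open>For a ring \<open>A\<close> and an \<open>A\<close>-bimodule \<open>M\<close>: as in \<open>HOL-Algebra.Module\<close>, the abelian group
  of \<open>M\<close> is carried by the additive part of a ring record. The left and right actions are
  given by \<open>l a m = a m\<close> and \<open>r m a = m a\<close>.\<close>

definition trivial_extension ::
  "('a, 'c) ring_scheme \<Rightarrow> ('b, 'd) ring_scheme \<Rightarrow> ('a \<Rightarrow> 'b \<Rightarrow> 'b) \<Rightarrow> ('b \<Rightarrow> 'a \<Rightarrow> 'b) \<Rightarrow> ('a \<times> 'b) ring"
  where
  "trivial_extension A M l r =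
    \<lparr> carrier = carrier A \<times> carrier M,
      mult = (\<lambda>(a\<^sub>1, m\<^sub>1) (a\<^sub>2, m\<^sub>2). (a\<^sub>1 \<otimes>\<^bsub>A\<^esub> a\<^sub>2, l a\<^sub>1 m\<^sub>2 \<oplus>\<^bsub>M\<^esub> r m\<^sub>1 a\<^sub>2)),
      one = (\<one>\<^bsub>A\<^esub>, \<zero>\<^bsub>M\<^esub>),
      zero = (\<zero>\<^bsub>A\<^esub>, \<zero>\<^bsub>M\<^esub>),
      add = (\<lambda>(a\<^sub>1, m\<^sub>1) (a\<^sub>2, m\<^sub>2). (a\<^sub>1 \<oplus>\<^bsub>A\<^esub> a\<^sub>2, m\<^sub>1 \<oplus>\<^bsub>M\<^esub> m\<^sub>2)) \<rparr>"

abbreviation self_extension :: "('a, 'c) ring_scheme \<Rightarrow> ('a \<times> 'a) ring" where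
  "self_extension A \<equiv> trivial_extension A A (mult A) (mult A)"

lemma ring_self_extension:
  assumes "ring A"
  shows "ring (self_extension A)"
proof -
  interpret ring A by fact
  have "\<exists>y \<in> carrier A \<times> carrier A. fst y \<oplus>\<^bsub>A\<^esub> a = \<zero>\<^bsub>A\<^esub> \<and> snd y \<oplus>\<^bsub>A\<^esub> m = \<zero>\<^bsub>A\<^esub>"
    if "a \<in> carrier A" "m \<in> carrier A" for a m
    using that by (intro bexI[of _ "(\<ominus>\<^bsub>A\<^esub> a, \<ominus>\<^bsub>A\<^esub> m)"]) (auto simp: l_neg)
  then show ?thesis
    by (intro ringI abelian_groupI monoidI)
      (auto simp: trivial_extension_def m_assoc l_distr r_distr a_ac split_beta)
qed


text \<open>Only the values on \<open>carrier T\<close> matter.\<close>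

definition additive_map :: "('a, 'c) ring_scheme \<Rightarrow> ('a \<Rightarrow> 'a) \<Rightarrow> bool" where
  "additive_map T \<Delta> \<longleftrightarrow> \<Delta> \<in> hom (add_monoid T) (add_monoid T)"

definition jordan_derivation :: "('a, 'c) ring_scheme \<Rightarrow> ('a \<Rightarrow> 'a) \<Rightarrow> bool" where
  "jordan_derivation T \<Delta> \<longleftrightarrow> additive_map T \<Delta> \<and>
    (\<forall>x \<in> carrier T. \<forall>y \<in> carrier T.
      \<Delta> (x \<otimes>\<^bsub>T\<^esub> y \<oplus>\<^bsub>T\<^esub> y \<otimes>\<^bsub>T\<^esub> x) =
        \<Delta> x \<otimes>\<^bsub>T\<^esub> y \<oplus>\<^bsub>T\<^esub> x \<otimes>\<^bsub>T\<^esub> \<Delta> y \<oplus>\<^bsub>T\<^esub> \<Delta> y \<otimes>\<^bsub>T\<^esub> x \<oplus>\<^bsub>T\<^esub> y \<otimes>\<^bsub>T\<^esub> \<Delta> x)"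

definition derivation :: "('a, 'c) ring_scheme \<Rightarrow> ('a \<Rightarrow> 'a) \<Rightarrow> bool" where
  "derivation T \<Delta> \<longleftrightarrow> additive_map T \<Delta> \<and>
    (\<forall>x \<in> carrier T. \<forall>y \<in> carrier T.
      \<Delta> (x \<otimes>\<^bsub>T\<^esub> y) = \<Delta> x \<otimes>\<^bsub>T\<^esub> y \<oplus>\<^bsub>T\<^esub> x \<otimes>\<^bsub>T\<^esub> \<Delta> y)"

end

theory Submission
  imports Defs "HOL-Algebra.Multiplicative_Group"
begin

text \<open>
  The trivial extension of \<open>M\<^sub>n(R)\<close> by itself is the ring of matrices over the dual numbers of
  \<open>R\<close>, so it still has matrix units \<open>E\<^sub>i\<^sub>j\<close>. In a 2-torsion free ring, those of the first
  row and the first column suffice to force Jordan derivations to be derivations; this is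
  \<open>jordan_derivation_imp_derivation\<close>, which is applied with \<open>e = E\<^sub>0\<^sub>0\<close>, \<open>x = E\<^sub>0\<^sub>1\<close> and
  \<open>y = E\<^sub>1\<^sub>0\<close>.

  Let \<open>e\<close> be an idempotent of such a ring \<open>T\<close> and \<open>f = 1 - e\<close>. After subtracting an inner
  derivation, a Jordan derivation \<open>D\<close> kills \<open>e\<close> and \<open>f\<close>. The Jordan identity with \<open>e\<close> then shows that \<open>D\<close> maps
  the corners \<open>eTe\<close> and \<open>fTf\<close> into themselves, and \<open>eTf\<close> into \<open>eTf + fTe\<close>. The obstruction is
  the component \<open>\<sigma>: eTf \<rightarrow> fTe\<close> and its mirror image. Being of Jordan type, \<open>\<sigma>\<close> reverses
  products: \<open>\<sigma>(az) = \<sigma>(z)a\<close> and \<open>\<sigma>(zb) = b\<sigma>(z)\<close>. Computing \<open>\<sigma>(xyz)\<close> in two ways for \<open>x, z\<close> in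
  \<open>eTf\<close> and \<open>y\<close> in \<open>fTe\<close> gives \<open>\<sigma>(z)xy = yz\<sigma>(x)\<close>, and the Jordan identity for \<open>xz + zx = 0\<close>
  gives \<open>z\<sigma>(x) = -x\<sigma>(z)\<close>; hence \<open>\<sigma>(z)xy + yx\<sigma>(z) = 0\<close> (\<open>crossing_twisted\<close>). When \<open>xy = e\<close>,
  this says that the idempotent \<open>yx\<close> acts on \<open>\<sigma>(z)\<close> as \<open>-1\<close>, which in the absence of
  2-torsion is possible only for \<open>\<sigma>(z) = 0\<close>.

  So \<open>D\<close> respects all four corners. For \<open>u\<close> and \<open>v\<close> in corners the Jordan identity is the sum
  of the Leibniz rules for \<open>uv\<close> and for \<open>vu\<close>; unless both lie in the same diagonal corner, the
  two rules either live in different corners or one of them is trivial, and so both hold. The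
  Leibniz rule in a diagonal corner follows by letting it act on an off-diagonal corner
  (\<open>leibniz_diagonal\<close>), where faithfulness of the action is used.
\<close>

section \<open>Derivations and Jordan derivations\<close>

lemma derivation_is_jordan_derivation:
  assumes "ring R" and "derivation R \<delta>"
  shows "jordan_derivation R \<delta>"
proof -
  interpret ring R by fact
  have closed: "\<And>x. x \<in> carrier R \<Longrightarrow> \<delta> x \<in> carrier R"
    and add: "\<And>x y. x \<in> carrier R \<Longrightarrow> y \<in> carrier R \<Longrightarrow> \<delta> (x \<oplus>\<^bsub>R\<^esub> y) = \<delta> x \<oplus>\<^bsub>R\<^esub> \<delta> y"
    using assms(2) by (auto simp: derivation_def additive_map_def hom_def)
  show ?thesis
    using assms(2) by (simp add: derivation_def jordan_derivation_def add closed a_assoc)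
qed

lemma (in ring) inner_derivation:
  assumes d: "d \<in> carrier R"
  shows "derivation R (\<lambda>x. d \<otimes> x \<ominus> x \<otimes> d)"
proof -
  have "d \<otimes> (x \<otimes> y) \<ominus> x \<otimes> y \<otimes> d = (d \<otimes> x \<ominus> x \<otimes> d) \<otimes> y \<oplus> x \<otimes> (d \<otimes> y \<ominus> y \<otimes> d)"
    if "x \<in> carrier R" "y \<in> carrier R" for x y
  proof -
    have cancel: "u \<ominus> w = (u \<ominus> v) \<oplus> (v \<ominus> w)"
      if "u \<in> carrier R" "v \<in> carrier R" "w \<in> carrier R" for u v w
      using that by (simp add: minus_eq a_assoc r_neg1)
    \<comment> \<open>insert the mixed term \<open>xdy\<close>\<close>
    have "d \<otimes> (x \<otimes> y) \<ominus> x \<otimes> y \<otimes> d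
        = (d \<otimes> (x \<otimes> y) \<ominus> x \<otimes> (d \<otimes> y)) \<oplus> (x \<otimes> (d \<otimes> y) \<ominus> x \<otimes> y \<otimes> d)"
      using that d by (intro cancel) auto
    then show ?thesis
      using that d by (simp add: minus_eq l_distr r_distr l_minus r_minus m_assoc)
  qed
  then show ?thesis
    using d by (auto simp: derivation_def additive_map_def hom_def minus_eq
        l_distr r_distr minus_add a_ac)
qed

lemma (in ring) derivation_add:
  assumes "derivation R \<delta>" and "derivation R \<epsilon>"
  shows "derivation R (\<lambda>x. \<delta> x \<oplus> \<epsilon> x)"
  using assms by (auto simp: derivation_def additive_map_def hom_def l_distr r_distr a_ac Pi_iff)

lemma (in ring) jordan_derivation_diff:
  assumes \<delta>: "jordan_derivation R \<delta>" and \<epsilon>: "jordan_derivation R \<epsilon>"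
  shows "jordan_derivation R (\<lambda>x. \<delta> x \<ominus> \<epsilon> x)"
proof -
  have jordan: "\<delta> (x \<otimes> y \<oplus> y \<otimes> x) \<ominus> \<epsilon> (x \<otimes> y \<oplus> y \<otimes> x)
      = (\<delta> x \<ominus> \<epsilon> x) \<otimes> y \<oplus> x \<otimes> (\<delta> y \<ominus> \<epsilon> y) \<oplus> (\<delta> y \<ominus> \<epsilon> y) \<otimes> x \<oplus> y \<otimes> (\<delta> x \<ominus> \<epsilon> x)"
    if xy: "x \<in> carrier R" "y \<in> carrier R" for x y
  proof -
    have closed: "\<delta> x \<in> carrier R" "\<delta> y \<in> carrier R" "\<epsilon> x \<in> carrier R" "\<epsilon> y \<in> carrier R"
      using \<delta> \<epsilon> xy by (auto simp: jordan_derivation_def additive_map_def hom_def)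
    have "\<delta> (x \<otimes> y \<oplus> y \<otimes> x) = \<delta> x \<otimes> y \<oplus> x \<otimes> \<delta> y \<oplus> \<delta> y \<otimes> x \<oplus> y \<otimes> \<delta> x"
      "\<epsilon> (x \<otimes> y \<oplus> y \<otimes> x) = \<epsilon> x \<otimes> y \<oplus> x \<otimes> \<epsilon> y \<oplus> \<epsilon> y \<otimes> x \<oplus> y \<otimes> \<epsilon> x"
      using \<delta> \<epsilon> xy by (auto simp: jordan_derivation_def)
    then show ?thesis
      using xy closed by (simp add: minus_eq l_distr r_distr l_minus r_minus minus_add a_ac)
  qed
  have "(\<lambda>x. \<delta> x \<ominus> \<epsilon> x) \<in> hom (add_monoid R) (add_monoid R)"
    using \<delta> \<epsilon>
    by (auto simp: jordan_derivation_def additive_map_def hom_def minus_eq minus_add a_ac Pi_iff)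
  with jordan show ?thesis
    by (simp add: jordan_derivation_def additive_map_def)
qed

section \<open>Peirce corners\<close>

context ring
begin

text \<open>For idempotents \<open>r\<close> and \<open>s\<close> this is \<open>rRs\<close>; fixed points are easier to recognise and to
  rewrite with than an image.\<close>

definition corner :: "'a \<Rightarrow> 'a \<Rightarrow> 'a set" where
  "corner r s = {x \<in> carrier R. r \<otimes> x = x \<and> x \<otimes> s = x}"

lemma cornerD:
  assumes "x \<in> corner r s"
  shows "x \<in> carrier R" "r \<otimes> x = x" "x \<otimes> s = x"
  using assms by (auto simp: corner_def)

lemma corner_mult:
  assumes "x \<in> corner r s" "y \<in> corner s t" "r \<in> carrier R" "t \<in> carrier R"
  shows "x \<otimes> y \<in> corner r t"
  using assms by (auto simp: corner_def m_assoc) (simp flip: m_assoc)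

lemma corner_mult_zero:
  assumes "x \<in> corner r s" "y \<in> corner s' t" "s \<otimes> s' = \<zero>" "s \<in> carrier R" "s' \<in> carrier R"
  shows "x \<otimes> y = \<zero>"
proof -
  have "x \<otimes> y = (x \<otimes> s) \<otimes> (s' \<otimes> y)"
    using assms by (simp add: cornerD)
  also have "\<dots> = x \<otimes> (s \<otimes> s') \<otimes> y"
    using cornerD(1)[OF assms(1)] cornerD(1)[OF assms(2)] assms(4,5) by (simp add: m_assoc)
  finally show ?thesis
    using assms cornerD(1)[OF assms(1)] cornerD(1)[OF assms(2)] by simp
qed

text \<open>The next two lemmas supply, for a fixed corner element, the rewrite rules that evaluate
  right-nested products with idempotents in them.\<close>

lemma corner_assoc:
  assumes "x \<in> corner r s" "r \<in> carrier R" "s \<in> carrier R" "z \<in> carrier R"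
  shows "r \<otimes> (x \<otimes> z) = x \<otimes> z" "x \<otimes> (s \<otimes> z) = x \<otimes> z"
  using assms by (auto simp: corner_def simp flip: m_assoc)

lemma corner_annihilate:
  assumes "x \<in> corner r s" "r \<in> carrier R" "s \<in> carrier R" "t \<in> carrier R"
  shows "t \<otimes> r = \<zero> \<Longrightarrow> t \<otimes> x = \<zero>" "s \<otimes> t = \<zero> \<Longrightarrow> x \<otimes> t = \<zero>"
    and "t \<otimes> r = \<zero> \<Longrightarrow> z \<in> carrier R \<Longrightarrow> t \<otimes> (x \<otimes> z) = \<zero>"
    and "s \<otimes> t = \<zero> \<Longrightarrow> z \<in> carrier R \<Longrightarrow> x \<otimes> (t \<otimes> z) = \<zero>"
proof -
  have x: "x \<in> carrier R" "r \<otimes> x = x" "x \<otimes> s = x"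
    using assms(1) by (auto simp: corner_def)
  show 1: "t \<otimes> x = \<zero>" if "t \<otimes> r = \<zero>"
    using that x assms(2-) m_assoc[of t r x] by simp
  show 2: "x \<otimes> t = \<zero>" if "s \<otimes> t = \<zero>"
    using that x assms(2-) m_assoc[of x s t] by simp
  show "t \<otimes> (x \<otimes> z) = \<zero>" if "t \<otimes> r = \<zero>" "z \<in> carrier R"
    using that x assms(2-) 1 by (simp flip: m_assoc)
  show "x \<otimes> (t \<otimes> z) = \<zero>" if "s \<otimes> t = \<zero>" "z \<in> carrier R"
    using that x assms(2-) 2 by (simp flip: m_assoc)
qed

end

section \<open>Jordan derivations that kill a pair of complementary idempotents\<close>

text \<open>Both idempotents are parameters because the whole situation is symmetric in them: each
  statement about \<open>p\<close> and \<open>q\<close> can be used with the two exchanged.\<close>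

locale jordan_derivation_peirce = ring R for R (structure) +
  fixes p q :: 'a and D :: "'a \<Rightarrow> 'a"
  assumes two_torsion_free: "\<And>x. x \<in> carrier R \<Longrightarrow> x \<oplus> x = \<zero> \<Longrightarrow> x = \<zero>"
    and p [simp]: "p \<in> carrier R" and q [simp]: "q \<in> carrier R"
    and pp [simp]: "p \<otimes> p = p" and qq [simp]: "q \<otimes> q = q"
    and pq [simp]: "p \<otimes> q = \<zero>" and qp [simp]: "q \<otimes> p = \<zero>"
    and p_plus_q: "p \<oplus> q = \<one>"
    and jordan: "jordan_derivation R D"
    and D_p [simp]: "D p = \<zero>" and D_q [simp]: "D q = \<zero>"
begin

lemma swap: "jordan_derivation_peirce R q p D"
  using jordan p_plus_q
  by unfold_locales (erule two_torsion_free, assumption, simp_all add: a_comm)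

lemma D_closed [simp]: "x \<in> carrier R \<Longrightarrow> D x \<in> carrier R"
  and D_add: "x \<in> carrier R \<Longrightarrow> y \<in> carrier R \<Longrightarrow> D (x \<oplus> y) = D x \<oplus> D y"
  and D_jordan: "x \<in> carrier R \<Longrightarrow> y \<in> carrier R \<Longrightarrow>
    D (x \<otimes> y \<oplus> y \<otimes> x) = D x \<otimes> y \<oplus> x \<otimes> D y \<oplus> D y \<otimes> x \<oplus> y \<otimes> D x"
  using jordan by (auto simp: jordan_derivation_def additive_map_def hom_def)

lemma D_zero [simp]: "D \<zero> = \<zero>"
proof -
  have "D \<zero> \<oplus> D \<zero> = D \<zero>"
    using D_add[of \<zero> \<zero>] by simp
  then show ?thesis
    by simp
qed

lemma split_left: "x \<in> carrier R \<Longrightarrow> x = p \<otimes> x \<oplus> q \<otimes> x"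
  and split_right: "x \<in> carrier R \<Longrightarrow> x = x \<otimes> p \<oplus> x \<otimes> q"
  by (simp_all add: p_plus_q flip: l_distr r_distr)

lemma pp_assoc [simp]: "z \<in> carrier R \<Longrightarrow> p \<otimes> (p \<otimes> z) = p \<otimes> z"
  and qq_assoc [simp]: "z \<in> carrier R \<Longrightarrow> q \<otimes> (q \<otimes> z) = q \<otimes> z"
  and pq_assoc [simp]: "z \<in> carrier R \<Longrightarrow> p \<otimes> (q \<otimes> z) = \<zero>"
  and qp_assoc [simp]: "z \<in> carrier R \<Longrightarrow> q \<otimes> (p \<otimes> z) = \<zero>"
  by (simp_all flip: m_assoc)

lemmas corner_pp_simps = cornerD[where r = p and s = p] corner_assoc[OF _ p p]
  corner_annihilate(1,3)[OF _ p p q qp] corner_annihilate(2,4)[OF _ p p q pq]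
lemmas corner_pq_simps = cornerD[where r = p and s = q] corner_assoc[OF _ p q]
  corner_annihilate(1,3)[OF _ p q q qp] corner_annihilate(2,4)[OF _ p q p qp]
lemmas corner_qp_simps = cornerD[where r = q and s = p] corner_assoc[OF _ q p]
  corner_annihilate(1,3)[OF _ q p p pq] corner_annihilate(2,4)[OF _ q p q pq]
lemmas corner_qq_simps = cornerD[where r = q and s = q] corner_assoc[OF _ q q]
  corner_annihilate(1,3)[OF _ q q p pq] corner_annihilate(2,4)[OF _ q q p qp]

text \<open>For \<open>x\<close> in \<open>pRp\<close> the Jordan identity for \<open>xp + px = 2x\<close> reads \<open>2 D x = (D x) p + p (D x)\<close>.
  Comparing Peirce components, and using that there is no 2-torsion, leaves only \<open>p (D x) p\<close>.\<close>

lemma D_corner_pp: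
  assumes x: "x \<in> corner p p"
  shows "D x \<in> corner p p"
proof -
  define c where "c = D x"
  have c [simp]: "c \<in> carrier R"
    using x by (simp add: c_def cornerD)
  have two: "c \<oplus> c = c \<otimes> p \<oplus> p \<otimes> c"
    using D_jordan[of x p] x by (simp add: D_add c_def corner_pp_simps[OF x])
  have qcq: "q \<otimes> (c \<otimes> q) = \<zero>"
    using two_torsion_free[of "q \<otimes> (c \<otimes> q)"] arg_cong[OF two, of "\<lambda>z. q \<otimes> (z \<otimes> q)"]
    by (simp add: l_distr r_distr m_assoc)
  have qcp: "q \<otimes> (c \<otimes> p) = \<zero>"
    using arg_cong[OF two, of "\<lambda>z. q \<otimes> (z \<otimes> p)"]
    by (simp add: l_distr r_distr m_assoc)
  have pcq: "p \<otimes> (c \<otimes> q) = \<zero>"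
    using arg_cong[OF two, of "\<lambda>z. p \<otimes> (z \<otimes> q)"]
    by (simp add: l_distr r_distr m_assoc)
  have "q \<otimes> c = \<zero>"
    using split_right[of "q \<otimes> c"] by (simp add: m_assoc qcp qcq)
  moreover have "c \<otimes> q = \<zero>"
    using split_left[of "c \<otimes> q"] by (simp add: pcq qcq)
  ultimately show ?thesis
    using split_left[of c, symmetric] split_right[of c, symmetric]
    by (simp add: corner_def flip: c_def)
qed

text \<open>Here the identity for \<open>xp + px = x\<close> only removes the diagonal components: \<open>D x\<close> may still have
  a component in the opposite corner.\<close>

lemma D_corner_pq:
  assumes x: "x \<in> corner p q"
  shows "p \<otimes> (D x \<otimes> p) = \<zero>" "q \<otimes> (D x \<otimes> q) = \<zero>"
proof -
  define c where "c = D x"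
  have c [simp]: "c \<in> carrier R"
    using x by (simp add: c_def cornerD)
  have off: "c = c \<otimes> p \<oplus> p \<otimes> c"
    using D_jordan[of x p] x by (simp add: c_def corner_pq_simps[OF x])
  show "p \<otimes> (D x \<otimes> p) = \<zero>"
    using arg_cong[OF off, of "\<lambda>z. p \<otimes> (z \<otimes> p)"]
    by (simp add: l_distr r_distr m_assoc flip: c_def)
  show "q \<otimes> (D x \<otimes> q) = \<zero>"
    using arg_cong[OF off, of "\<lambda>z. q \<otimes> (z \<otimes> q)"]
    by (simp add: l_distr r_distr m_assoc flip: c_def)
qed

text \<open>The component of \<open>D x\<close> that has to be shown to vanish for \<open>x\<close> in \<open>pRq\<close>. By
  \<open>crossing_left\<close> and \<open>crossing_right\<close> it reverses products, as an antiderivation would.\<close>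

definition crossing :: "'a \<Rightarrow> 'a" where
  "crossing x = q \<otimes> (D x \<otimes> p)"

lemma crossing_corner:
  assumes "x \<in> carrier R"
  shows "crossing x \<in> corner q p"
  using assms by (auto simp: crossing_def corner_def m_assoc)

lemma crossing_left:
  assumes a: "a \<in> corner p p" and x: "x \<in> corner p q"
  shows "crossing (a \<otimes> x) = crossing x \<otimes> a"
proof -
  note [simp] = corner_pp_simps[OF a] corner_pq_simps[OF x] corner_pp_simps[OF D_corner_pp[OF a]]
  have "a \<otimes> x \<oplus> x \<otimes> a = a \<otimes> x"
    by (simp add: corner_mult_zero[OF x a])
  then have "D (a \<otimes> x) = D a \<otimes> x \<oplus> a \<otimes> D x \<oplus> D x \<otimes> a \<oplus> x \<otimes> D a"
    using D_jordan[of a x] by simp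
  then show ?thesis
    by (simp add: crossing_def l_distr r_distr m_assoc)
qed

lemma crossing_right:
  assumes b: "b \<in> corner q q" and x: "x \<in> corner p q"
  shows "crossing (x \<otimes> b) = b \<otimes> crossing x"
proof -
  interpret swap: jordan_derivation_peirce R q p D by (rule swap)
  note [simp] = corner_qq_simps[OF b] corner_pq_simps[OF x] corner_qq_simps[OF swap.D_corner_pp[OF b]]
  have "x \<otimes> b \<oplus> b \<otimes> x = x \<otimes> b"
    by (simp add: corner_mult_zero[OF b x])
  then have "D (x \<otimes> b) = D x \<otimes> b \<oplus> x \<otimes> D b \<oplus> D b \<otimes> x \<oplus> b \<otimes> D x"
    using D_jordan[of x b] by simp
  then show ?thesis
    by (simp add: crossing_def l_distr r_distr m_assoc)
qed

text \<open>The \<open>pRp\<close>-component of the Jordan identity for \<open>xz + zx = 0\<close>.\<close>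

lemma crossing_skew:
  assumes x: "x \<in> corner p q" and z: "z \<in> corner p q"
  shows "x \<otimes> crossing z \<oplus> z \<otimes> crossing x = \<zero>"
proof -
  note [simp] = corner_pq_simps[OF x] corner_pq_simps[OF z]
  have "x \<otimes> z \<oplus> z \<otimes> x = \<zero>"
    by (simp add: corner_mult_zero[OF x z] corner_mult_zero[OF z x])
  then have "\<zero> = D x \<otimes> z \<oplus> x \<otimes> D z \<oplus> D z \<otimes> x \<oplus> z \<otimes> D x"
    using D_jordan[of x z] by simp
  from arg_cong[OF this, of "\<lambda>w. p \<otimes> (w \<otimes> p)"] show ?thesis
    by (simp add: crossing_def l_distr r_distr m_assoc)
qed

text \<open>Both \<open>xy\<close> in \<open>pRp\<close> and \<open>yz\<close> in \<open>qRq\<close> can be moved through \<open>crossing\<close> in \<open>xyz\<close>; the two results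
  are compared by means of \<open>crossing_skew\<close>.\<close>

lemma crossing_twisted:
  assumes x: "x \<in> corner p q" and y: "y \<in> corner q p" and z: "z \<in> corner p q"
  shows "crossing z \<otimes> (x \<otimes> y) \<oplus> (y \<otimes> x) \<otimes> crossing z = \<zero>"
proof -
  note [simp] = corner_pq_simps[OF x] corner_qp_simps[OF y] corner_pq_simps[OF z]
    cornerD[OF crossing_corner]
  have xy: "x \<otimes> y \<in> corner p p" and yz: "y \<otimes> z \<in> corner q q"
    using corner_mult x y z p q by blast+
  have "crossing z \<otimes> (x \<otimes> y) = crossing (x \<otimes> y \<otimes> z)"
    by (simp add: crossing_left[OF xy z])
  also have "\<dots> = y \<otimes> z \<otimes> crossing x"
    using crossing_right[OF yz x] by (simp add: m_assoc)
  finally have "crossing z \<otimes> (x \<otimes> y) \<oplus> (y \<otimes> x) \<otimes> crossing z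
      = y \<otimes> (x \<otimes> crossing z \<oplus> z \<otimes> crossing x)"
    by (simp add: m_assoc r_distr a_comm)
  then show ?thesis
    by (simp add: crossing_skew[OF x z])
qed

text \<open>An idempotent has no eigenvalue \<open>-1\<close>: if \<open>ws = -s\<close> with \<open>w\<close> idempotent, then \<open>ws = -ws\<close>,
  so \<open>ws = 0\<close> in the absence of 2-torsion.\<close>

lemma eq_zero_if_left_idempotent_skew:
  assumes s: "s \<in> carrier R" "w \<in> carrier R" and "w \<otimes> w = w" "s \<oplus> w \<otimes> s = \<zero>"
  shows "s = \<zero>"
proof -
  have "w \<otimes> s \<oplus> w \<otimes> s = \<zero>"
    using arg_cong[OF assms(4), of "\<lambda>v. w \<otimes> v"] m_assoc[of w w s, symmetric] s assms(3)
    by (simp add: r_distr)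
  then have "w \<otimes> s = \<zero>"
    using s two_torsion_free[of "w \<otimes> s"] by simp
  then show ?thesis
    using assms(4) s by simp
qed

lemma eq_zero_if_right_idempotent_skew:
  assumes s: "s \<in> carrier R" "w \<in> carrier R" and "w \<otimes> w = w" "s \<otimes> w \<oplus> s = \<zero>"
  shows "s = \<zero>"
proof -
  have "s \<otimes> w \<oplus> s \<otimes> w = \<zero>"
    using arg_cong[OF assms(4), of "\<lambda>v. v \<otimes> w"] s assms(3)
    by (simp add: l_distr m_assoc)
  then have "s \<otimes> w = \<zero>"
    using s two_torsion_free[of "s \<otimes> w"] by simp
  then show ?thesis
    using assms(4) s by simp
qed

text \<open>The alternative in \<open>unit\<close> makes the statement apply to both off-diagonal corners with the same
  pair of elements: exchanging \<open>p\<close> with \<open>q\<close> and \<open>x\<close> with \<open>y\<close> turns \<open>xy = p\<close> into \<open>yx = q\<close>. In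
  either case one of the products in \<open>crossing_twisted\<close> is a unit on \<open>qRp\<close> and the other one
  is idempotent.\<close>

lemma D_corner_pq_closed:
  assumes x: "x \<in> corner p q" and y: "y \<in> corner q p" and unit: "x \<otimes> y = p \<or> y \<otimes> x = q"
    and z: "z \<in> corner p q"
  shows "D z \<in> corner p q"
proof -
  note [simp] = corner_pq_simps[OF x] corner_qp_simps[OF y] corner_pq_simps[OF z]
    cornerD[OF crossing_corner]
  have twisted: "crossing z \<otimes> (x \<otimes> y) \<oplus> (y \<otimes> x) \<otimes> crossing z = \<zero>"
    by (rule crossing_twisted[OF x y z])
  have "crossing z = \<zero>"
    using unit
  proof
    assume xy: "x \<otimes> y = p"
    have "(y \<otimes> x) \<otimes> (y \<otimes> x) = y \<otimes> ((x \<otimes> y) \<otimes> x)"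
      by (simp add: m_assoc)
    also have "\<dots> = y \<otimes> x"
      by (simp add: xy)
    finally have "(y \<otimes> x) \<otimes> (y \<otimes> x) = y \<otimes> x" .
    then show ?thesis
      using twisted xy z eq_zero_if_left_idempotent_skew[of "crossing z" "y \<otimes> x"] by simp
  next
    assume yx: "y \<otimes> x = q"
    have "(x \<otimes> y) \<otimes> (x \<otimes> y) = x \<otimes> ((y \<otimes> x) \<otimes> y)"
      by (simp add: m_assoc)
    also have "\<dots> = x \<otimes> y"
      by (simp add: yx)
    finally have "(x \<otimes> y) \<otimes> (x \<otimes> y) = x \<otimes> y" .
    then show ?thesis
      using twisted yx z eq_zero_if_right_idempotent_skew[of "crossing z" "x \<otimes> y"] by simp
  qed
  then have qDp: "q \<otimes> (D z \<otimes> p) = \<zero>"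
    by (simp add: crossing_def)
  have "q \<otimes> D z = \<zero>"
    using split_right[of "q \<otimes> D z"] by (simp add: m_assoc qDp D_corner_pq[OF z])
  moreover have "D z \<otimes> p = \<zero>"
    using split_left[of "D z \<otimes> p"] by (simp add: qDp D_corner_pq[OF z])
  ultimately show ?thesis
    using split_left[of "D z", symmetric] split_right[of "D z", symmetric] by (simp add: corner_def)
qed

text \<open>Additive statements may be checked on the four corners, by the Peirce decomposition.\<close>

lemma corner_induct [consumes 1, case_names add corner]:
  assumes x: "x \<in> carrier R"
    and add: "\<And>x y. x \<in> carrier R \<Longrightarrow> y \<in> carrier R \<Longrightarrow> P x \<Longrightarrow> P y \<Longrightarrow> P (x \<oplus> y)"
    and corner: "\<And>r s x. r \<in> {p, q} \<Longrightarrow> s \<in> {p, q} \<Longrightarrow> x \<in> corner r s \<Longrightarrow> P x"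
  shows "P x"
proof -
  have piece: "P (r \<otimes> (x \<otimes> s))" if "r \<in> {p, q}" "s \<in> {p, q}" for r s
    using that x by (intro corner[OF that]) (auto simp: corner_def m_assoc)
  have "P (r \<otimes> x)" if "r \<in> {p, q}" for r
  proof -
    have "P (r \<otimes> (x \<otimes> p) \<oplus> r \<otimes> (x \<otimes> q))"
      using that x by (intro add piece) auto
    also have "r \<otimes> (x \<otimes> p) \<oplus> r \<otimes> (x \<otimes> q) = r \<otimes> x"
      using that x arg_cong[OF split_right[OF x], of "\<lambda>w. r \<otimes> w"] by (auto simp: r_distr)
    finally show ?thesis .
  qed
  then have "P (p \<otimes> x \<oplus> q \<otimes> x)"
    using x by (intro add) auto
  then show ?thesis
    using split_left[OF x, symmetric] by simp
qed

definition leibniz :: "'a \<Rightarrow> 'a \<Rightarrow> bool" where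
  "leibniz x y \<longleftrightarrow> D (x \<otimes> y) = D x \<otimes> y \<oplus> x \<otimes> D y"

lemma leibniz_add_left:
  assumes "leibniz x z" "leibniz y z" "x \<in> carrier R" "y \<in> carrier R" "z \<in> carrier R"
  shows "leibniz (x \<oplus> y) z"
  using assms by (simp add: leibniz_def D_add l_distr r_distr a_ac)

lemma leibniz_add_right:
  assumes "leibniz z x" "leibniz z y" "x \<in> carrier R" "y \<in> carrier R" "z \<in> carrier R"
  shows "leibniz z (x \<oplus> y)"
  using assms by (simp add: leibniz_def D_add l_distr r_distr a_ac)

text \<open>The Jordan identity is the sum of the Leibniz rules for \<open>xy\<close> and for \<open>yx\<close>.\<close>

lemma leibniz_commute:
  assumes "leibniz y x" "x \<in> carrier R" "y \<in> carrier R"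
  shows "leibniz x y"
proof -
  have "D (x \<otimes> y) \<oplus> D (y \<otimes> x) = (D x \<otimes> y \<oplus> x \<otimes> D y) \<oplus> (D y \<otimes> x \<oplus> y \<otimes> D x)"
    using D_jordan[of x y] assms(2,3) by (simp add: D_add a_assoc)
  then show ?thesis
    using assms by (simp add: leibniz_def)
qed

end

section \<open>The Leibniz rule on corners\<close>

text \<open>Corners are indexed by elements of \<open>{p, q}\<close>, so that the sixteen pairs of corners fall
  into a few cases. The assumption \<open>faithful\<close> says that each diagonal corner acts
  faithfully, from the left, on the off-diagonal corner in the same row.\<close>

locale corner_preserving = jordan_derivation_peirce +
  assumes D_corner: "\<And>r s x. r \<in> {p, q} \<Longrightarrow> s \<in> {p, q} \<Longrightarrow> x \<in> corner r s \<Longrightarrow> D x \<in> corner r s"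
    and faithful: "\<And>r r' b. r \<in> {p, q} \<Longrightarrow> r' \<in> {p, q} \<Longrightarrow> r \<noteq> r' \<Longrightarrow> b \<in> corner r r \<Longrightarrow>
      (\<And>z. z \<in> corner r r' \<Longrightarrow> b \<otimes> z = \<zero>) \<Longrightarrow> b = \<zero>"
begin

lemma orthogonal: "r \<in> {p, q} \<Longrightarrow> s \<in> {p, q} \<Longrightarrow> r \<noteq> s \<Longrightarrow> r \<otimes> s = \<zero>"
  by auto

lemma idempotent_closed: "r \<in> {p, q} \<Longrightarrow> r \<in> carrier R"
  by auto

text \<open>All three terms of the Leibniz rule vanish.\<close>

lemma leibniz_corners_not_composable:
  assumes "r \<in> {p, q}" "s \<in> {p, q}" "s' \<in> {p, q}" "t \<in> {p, q}" "s \<noteq> s'"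
    and x: "x \<in> corner r s" and y: "y \<in> corner s' t"
  shows "leibniz x y"
proof -
  have "x' \<otimes> y' = \<zero>" if "x' \<in> corner r s" "y' \<in> corner s' t" for x' y'
    using that assms(2,3,5) by (auto intro: corner_mult_zero[OF that] orthogonal)
  then show ?thesis
    using assms by (simp add: leibniz_def D_corner)
qed

text \<open>If \<open>r \<noteq> t\<close>, then \<open>yx = 0\<close> and the rule for \<open>yx\<close> is trivial. If \<open>r = t \<noteq> s\<close>, the rule for \<open>xy\<close>
  lives in \<open>rRr\<close> and the one for \<open>yx\<close> in \<open>sRs\<close>, so multiplying the Jordan identity by \<open>r\<close>
  separates them.\<close>

lemma leibniz_off_diagonal:
  assumes r: "r \<in> {p, q}" and s: "s \<in> {p, q}" and t: "t \<in> {p, q}" and "\<not> (r = s \<and> s = t)"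
    and x: "x \<in> corner r s" and y: "y \<in> corner s t"
  shows "leibniz x y"
proof (cases "r = t")
  case False
  then have "leibniz y x"
    using assms by (intro leibniz_corners_not_composable[of s t r s]) auto
  then show ?thesis
    using leibniz_commute[of y x] cornerD(1)[OF x] cornerD(1)[OF y] by simp
next
  case True
  then have "r \<noteq> s"
    using assms(4) by auto
  note y = y[folded True]
  note [simp] = cornerD(1)[OF x] cornerD(1)[OF y] idempotent_closed[OF r] idempotent_closed[OF s]
  have Dx: "D x \<in> corner r s" and Dy: "D y \<in> corner s r"
    using D_corner x y r s by auto
  have in_r: "x \<otimes> y \<in> corner r r" "D x \<otimes> y \<in> corner r r" "x \<otimes> D y \<in> corner r r"
    and in_s: "y \<otimes> x \<in> corner s s" "D y \<otimes> x \<in> corner s s" "y \<otimes> D x \<in> corner s s"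
    using x y Dx Dy by (auto intro!: corner_mult[of _ r s _ r] corner_mult[of _ s r _ s])
  have D_in: "D (x \<otimes> y) \<in> corner r r" "D (y \<otimes> x) \<in> corner s s"
    using D_corner r s in_r in_s by auto
  have rs: "r \<otimes> s = \<zero>"
    using orthogonal r s \<open>r \<noteq> s\<close> by auto
  have kill: "r \<otimes> w = \<zero>" if "w \<in> corner s s" for w
    using that rs corner_annihilate(1)[of w s s r] by simp
  have keep: "r \<otimes> w = w" if "w \<in> corner r r" for w
    using that by (simp add: cornerD)
  have "D (x \<otimes> y) \<oplus> D (y \<otimes> x) = D x \<otimes> y \<oplus> x \<otimes> D y \<oplus> D y \<otimes> x \<oplus> y \<otimes> D x"
    using D_jordan[of x y] by (simp add: D_add)
  from arg_cong[OF this, of "\<lambda>w. r \<otimes> w"] show ?thesis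
    by (simp add: leibniz_def r_distr keep[OF in_r(2)] keep[OF in_r(3)] keep[OF D_in(1)]
        kill[OF in_s(2)] kill[OF in_s(3)] kill[OF D_in(2)])
qed

text \<open>For off-diagonal \<open>z\<close>, expanding \<open>D (abz)\<close> by the rules for \<open>(ab)z\<close> and for \<open>a(bz)\<close>, which are
  known, shows that the defect \<open>d\<close> of the rule for \<open>ab\<close> annihilates \<open>z\<close>.\<close>

lemma leibniz_diagonal:
  assumes r: "r \<in> {p, q}" and a: "a \<in> corner r r" and b: "b \<in> corner r r"
  shows "leibniz a b"
proof (cases "p = q")
  case True
  \<comment> \<open>the two idempotents coincide only in the zero ring, where no other index \<open>r'\<close> exists\<close>
  then have "r = \<zero>"
    using r pq pp by auto
  then have "a = \<zero>" "b = \<zero>"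
    using cornerD(1,2)[OF a] cornerD(1,2)[OF b] l_null by metis+
  then show ?thesis
    by (simp add: leibniz_def)
next
  case False
  then obtain r' where r': "r' \<in> {p, q}" "r \<noteq> r'"
    using r by auto
  note closed [simp] = cornerD(1)[OF a] cornerD(1)[OF b]
    idempotent_closed[OF r] idempotent_closed[OF r'(1)]
  define v where "v = D a \<otimes> b \<oplus> a \<otimes> D b"
  define d where "d = D (a \<otimes> b) \<ominus> v"
  have Da: "D a \<in> corner r r" and Db: "D b \<in> corner r r"
    and ab: "a \<otimes> b \<in> corner r r" and Dab: "D (a \<otimes> b) \<in> corner r r"
    using D_corner[OF r r] corner_mult[OF a b] a b by auto
  have v: "v \<in> corner r r"
    unfolding v_def using corner_mult[OF Da b] corner_mult[OF a Db]
    by (auto simp: corner_def l_distr r_distr)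
  have d: "d \<in> corner r r"
    unfolding d_def using Dab v by (auto simp: corner_def minus_eq l_distr r_distr l_minus r_minus)
  have "d \<otimes> z = \<zero>" if z: "z \<in> corner r r'" for z
  proof -
    note [simp] = cornerD(1)[OF z]
    have bz: "b \<otimes> z \<in> corner r r'"
      using corner_mult[OF b z] by simp
    have off: "leibniz u w" if "u \<in> corner r r" "w \<in> corner r r'" for u w
      using that r r' by (intro leibniz_off_diagonal) auto
    have "D (a \<otimes> b) \<otimes> z \<oplus> a \<otimes> (b \<otimes> D z) = D (a \<otimes> b \<otimes> z)"
      using off[OF ab z] by (simp add: leibniz_def m_assoc)
    also have "\<dots> = D a \<otimes> (b \<otimes> z) \<oplus> a \<otimes> (D b \<otimes> z \<oplus> b \<otimes> D z)"
      using off[OF a bz] off[OF b z] by (simp add: leibniz_def m_assoc)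
    also have "\<dots> = v \<otimes> z \<oplus> a \<otimes> (b \<otimes> D z)"
      by (simp add: v_def l_distr r_distr m_assoc a_assoc)
    finally have "D (a \<otimes> b) \<otimes> z = v \<otimes> z"
      using cornerD(1)[OF v] by simp
    then show ?thesis
      using cornerD(1)[OF v] by (simp add: d_def minus_eq l_distr l_minus r_neg)
  qed
  then have "d = \<zero>"
    using faithful[OF r r' d] by blast
  then show ?thesis
    using cornerD(1)[OF v] by (simp add: leibniz_def d_def v_def)
qed

lemma derivation_D: "derivation R D"
proof -
  have "leibniz x y" if x: "x \<in> carrier R" and y: "y \<in> carrier R" for x y
    using x
  proof (induction rule: corner_induct)
    case (add x x')
    then show ?case
      using y by (intro leibniz_add_left)
  next
    case (corner r s x)
    show ?case
      using y
    proof (induction rule: corner_induct)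
      case (add y y')
      then show ?case
        using cornerD(1)[OF corner(3)] by (intro leibniz_add_right)
    next
      case (corner s' t y)
      note r = \<open>r \<in> {p, q}\<close> and s = \<open>s \<in> {p, q}\<close> and x = \<open>x \<in> corner r s\<close>
      note s' = corner(1) and t = corner(2) and y = corner(3)
      consider "s \<noteq> s'" | "s = s'" "\<not> (r = s \<and> s = t)" | "r = s" "s = s'" "s = t"
        by blast
      then show ?case
      proof cases
        case 1
        then show ?thesis
          using leibniz_corners_not_composable[OF r s s' t _ x y] by blast
      next
        case 2
        then show ?thesis
          using leibniz_off_diagonal[OF r s t _ x] y by blast
      next
        case 3
        then show ?thesis
          using leibniz_diagonal[OF r, of x y] x y by blast
      qed
    qed
  qed
  then show ?thesis
    using jordan by (simp add: derivation_def jordan_derivation_def leibniz_def)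
qed

end

section \<open>Rings with an idempotent and a pair of matrix units\<close>

text \<open>The elements \<open>e\<close>, \<open>x\<close>, \<open>y\<close> behave like \<open>E\<^sub>0\<^sub>0\<close>, \<open>E\<^sub>0\<^sub>1\<close>, \<open>E\<^sub>1\<^sub>0\<close>. The assumption \<open>faithful\<close>, that \<open>R\<close>
  acts faithfully on the left ideal \<open>Re\<close>, serves the corner \<open>fRf\<close>; on \<open>eRe\<close> the action is
  faithful because \<open>b = bxy\<close>.\<close>

theorem (in ring) jordan_derivation_imp_derivation:
  assumes two_torsion_free: "\<And>x. x \<in> carrier R \<Longrightarrow> x \<oplus> x = \<zero> \<Longrightarrow> x = \<zero>"
    and e [simp]: "e \<in> carrier R" and x [simp]: "x \<in> carrier R" and y [simp]: "y \<in> carrier R"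
    and ee [simp]: "e \<otimes> e = e" and ex: "e \<otimes> x = x" and xe: "x \<otimes> e = \<zero>"
    and ey: "e \<otimes> y = \<zero>" and ye: "y \<otimes> e = y" and xy: "x \<otimes> y = e"
    and faithful: "\<And>b. b \<in> carrier R \<Longrightarrow> (\<And>z. z \<in> carrier R \<Longrightarrow> b \<otimes> z \<otimes> e = \<zero>) \<Longrightarrow> b = \<zero>"
    and jordan: "jordan_derivation R \<Delta>"
  shows "derivation R \<Delta>"
proof -
  define f where "f = \<one> \<ominus> e"
  have f [simp]: "f \<in> carrier R"
    by (simp add: f_def)
  have ee_assoc: "e \<otimes> (e \<otimes> u) = e \<otimes> u" if "u \<in> carrier R" for u
    using that by (simp flip: m_assoc)
  have e_plus_f: "e \<oplus> f = \<one>"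
    by (simp add: f_def minus_eq a_comm[of \<one>] r_neg2)
  have ef [simp]: "e \<otimes> f = \<zero>" and fe [simp]: "f \<otimes> e = \<zero>"
    by (simp_all add: f_def minus_eq l_distr r_distr l_minus r_minus r_neg)
  have ff [simp]: "f \<otimes> f = f"
    using arg_cong[OF e_plus_f, of "\<lambda>u. u \<otimes> f"] by (simp add: l_distr)
  have \<Delta> [simp]: "\<And>x. x \<in> carrier R \<Longrightarrow> \<Delta> x \<in> carrier R"
    and \<Delta>_add: "\<And>x y. x \<in> carrier R \<Longrightarrow> y \<in> carrier R \<Longrightarrow> \<Delta> (x \<oplus> y) = \<Delta> x \<oplus> \<Delta> y"
    and \<Delta>_jordan: "\<And>x y. x \<in> carrier R \<Longrightarrow> y \<in> carrier R \<Longrightarrow>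
      \<Delta> (x \<otimes> y \<oplus> y \<otimes> x) = \<Delta> x \<otimes> y \<oplus> x \<otimes> \<Delta> y \<oplus> \<Delta> y \<otimes> x \<oplus> y \<otimes> \<Delta> x"
    using jordan by (auto simp: jordan_derivation_def additive_map_def hom_def)
  have half: "u = v" if "u \<oplus> u = v \<oplus> v" "u \<in> carrier R" "v \<in> carrier R" for u v
  proof -
    have "(u \<ominus> v) \<oplus> (u \<ominus> v) = (u \<oplus> u) \<ominus> (v \<oplus> v)"
      using that(2,3) by (simp add: minus_eq minus_add a_ac)
    also have "\<dots> = \<zero>"
      using that by (simp add: minus_eq r_neg)
    finally have "u \<ominus> v = \<zero>"
      using that(2,3) two_torsion_free[OF minus_closed] by blast
    then show ?thesis
      using that(2,3) by simp
  qed
  have \<Delta>_e: "\<Delta> e = \<Delta> e \<otimes> e \<oplus> e \<otimes> \<Delta> e"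
  proof (rule half)
    show "\<Delta> e \<oplus> \<Delta> e = (\<Delta> e \<otimes> e \<oplus> e \<otimes> \<Delta> e) \<oplus> (\<Delta> e \<otimes> e \<oplus> e \<otimes> \<Delta> e)"
      using \<Delta>_jordan[of e e] by (simp add: \<Delta>_add a_assoc)
  qed simp_all
  have e\<Delta>e: "e \<otimes> (\<Delta> e \<otimes> e) = \<zero>"
    using arg_cong[OF \<Delta>_e, of "\<lambda>u. e \<otimes> u \<otimes> e"] by (simp add: l_distr r_distr m_assoc ee_assoc)
  \<comment> \<open>since \<open>\<Delta> e\<close> has no diagonal components, its commutator with \<open>e\<close>, taken twice, gives \<open>\<Delta> e\<close> back\<close>
  define d where "d = \<Delta> e \<otimes> e \<ominus> e \<otimes> \<Delta> e"
  have d [simp]: "d \<in> carrier R"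
    by (simp add: d_def)
  have inner: "derivation R (\<lambda>x. d \<otimes> x \<ominus> x \<otimes> d)"
    by (rule inner_derivation) simp
  define D where "D x = \<Delta> x \<ominus> (d \<otimes> x \<ominus> x \<otimes> d)" for x
  have D: "jordan_derivation R D"
    unfolding D_def
    using jordan_derivation_diff[OF jordan derivation_is_jordan_derivation[OF ring_axioms inner]] .
  have "d \<otimes> e \<ominus> e \<otimes> d = \<Delta> e \<otimes> e \<oplus> e \<otimes> \<Delta> e"
    using e\<Delta>e by (simp add: d_def minus_eq l_distr r_distr l_minus r_minus m_assoc minus_add
        ee_assoc)
  then have D_e: "D e = \<zero>"
    by (simp add: D_def minus_eq r_neg flip: \<Delta>_e)
  have D_f: "D f = \<zero>"
  proof -
    have D_closed: "\<And>u. u \<in> carrier R \<Longrightarrow> D u \<in> carrier R"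
      by (simp add: D_def)
    \<comment> \<open>the Jordan identity for the pair \<open>1, 1\<close> says \<open>2 D 1 = 4 D 1\<close>\<close>
    have "D \<one> \<oplus> D \<one> = (D \<one> \<oplus> D \<one>) \<oplus> (D \<one> \<oplus> D \<one>)"
      using D D_closed[of \<one>]
      by (auto simp: jordan_derivation_def additive_map_def hom_def a_ac dest!: bspec[of _ _ \<one>])
    then have "D \<one> = \<zero>"
      using D_closed[of \<one>] two_torsion_free[of "D \<one>"] by simp
    moreover have "D (e \<oplus> f) = D e \<oplus> D f"
      using D by (auto simp: jordan_derivation_def additive_map_def hom_def)
    ultimately show ?thesis
      using D_closed[of f] by (simp add: e_plus_f D_e)
  qed
  interpret jordan_derivation_peirce R e f D
    using e_plus_f D D_e D_f
    by unfold_locales (erule two_torsion_free, assumption, simp_all)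
  interpret swap: jordan_derivation_peirce R f e D by (rule swap)
  have x_corner: "x \<in> corner e f" and y_corner: "y \<in> corner f e"
    using ex xe ey ye
    by (auto simp: corner_def f_def minus_eq l_distr r_distr l_minus r_minus)
  have preserved: "D z \<in> corner r s" if "r \<in> {e, f}" "s \<in> {e, f}" "z \<in> corner r s" for r s z
    using that D_corner_pp swap.D_corner_pp D_corner_pq_closed[OF x_corner y_corner]
      swap.D_corner_pq_closed[OF y_corner x_corner] xy by auto
  have no_annihilator: "b = \<zero>"
    if r: "r \<in> {e, f}" "r' \<in> {e, f}" "r \<noteq> r'" and b: "b \<in> corner r r"
      and ann: "\<And>z. z \<in> corner r r' \<Longrightarrow> b \<otimes> z = \<zero>" for r r' b
  proof -
    note [simp] = cornerD(1)[OF b]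
    consider "r = e" "r' = f" | "r = f" "r' = e"
      using r by auto
    then show ?thesis
    proof cases
      case 1
      then have "b \<otimes> (x \<otimes> y) = \<zero>"
        using ann[of x] x_corner by (simp flip: m_assoc)
      then show ?thesis
        using b 1 xy by (simp add: cornerD)
    next
      case 2
      have "b \<otimes> z \<otimes> e = \<zero>" if z [simp]: "z \<in> carrier R" for z
      proof -
        have "f \<otimes> (z \<otimes> e) \<in> corner f e"
          by (auto simp: corner_def m_assoc)
        then have "b \<otimes> (f \<otimes> (z \<otimes> e)) = \<zero>"
          using ann 2 by simp
        then show ?thesis
          using 2 b by (simp add: corner_qq_simps m_assoc)
      qed
      then show ?thesis
        by (rule faithful[OF cornerD(1)[OF b]])
    qed
  qed
  interpret corner_preserving R e f D
    by unfold_locales (fact preserved, fact no_annihilator)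
  have "derivation R (\<lambda>x. D x \<oplus> (d \<otimes> x \<ominus> x \<otimes> d))"
    by (rule derivation_add[OF derivation_D inner])
  moreover have "D x \<oplus> (d \<otimes> x \<ominus> x \<otimes> d) = \<Delta> x" if "x \<in> carrier R" for x
    using that by (simp add: D_def minus_eq a_assoc l_neg)
  ultimately show ?thesis
    by (auto simp: derivation_def additive_map_def hom_def)
qed

section \<open>Matrix units in the trivial extension\<close>

definition matrix_unit :: "nat \<Rightarrow> nat \<Rightarrow> nat \<Rightarrow> 'a :: {ring, monoid_mult} mat" where
  "matrix_unit n i j = mat n n (\<lambda>(k, l). if k = i \<and> l = j then 1 else 0)"

lemma matrix_unit_carrier [simp]: "matrix_unit n i j \<in> carrier_mat n n"
  by (simp add: matrix_unit_def)

lemma mult_matrix_unit_index: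
  assumes "B \<in> carrier_mat n n" "i < n" "k < n" "l < n"
  shows "(B * matrix_unit n i j) $$ (k, l) = (if l = j then B $$ (k, i) else 0)"
proof -
  have "(B * matrix_unit n i j) $$ (k, l)
      = (\<Sum>m = 0..<n. B $$ (k, m) * (if m = i \<and> l = j then 1 else 0))"
    using assms by (simp add: times_mat_def scalar_prod_def matrix_unit_def)
  also have "\<dots> = (\<Sum>m = 0..<n. if m = i then (if l = j then B $$ (k, i) else 0) else 0)"
    by (intro sum.cong) auto
  finally show ?thesis
    using assms by simp
qed

lemma matrix_unit_mult:
  assumes "i < n" "j < n" "k < n" "l < n"
  shows "matrix_unit n i j * matrix_unit n k l
    = (if j = k then matrix_unit n i l else 0\<^sub>m n n :: 'a :: {ring, monoid_mult} mat)"
proof (rule eq_matI)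
  fix a b
  let ?R = "if j = k then matrix_unit n i l else 0\<^sub>m n n :: 'a mat"
  assume "a < dim_row ?R" "b < dim_col ?R"
  then have "a < n" "b < n"
    by (auto simp: matrix_unit_def split: if_splits)
  then show "(matrix_unit n i j * matrix_unit n k l) $$ (a, b) = ?R $$ (a, b)"
    using assms mult_matrix_unit_index[of "matrix_unit n i j :: 'a mat" n k a b l]
    by (auto simp: matrix_unit_def)
qed (auto simp: matrix_unit_def)

theorem theorem4p4:
  fixes n :: nat
    and \<Delta> :: "'a :: {ring, monoid_mult} mat \<times> 'a mat \<Rightarrow> 'a mat \<times> 'a mat"
  assumes two_torsion_free: "\<And>x :: 'a. x + x = 0 \<Longrightarrow> x = 0"
    and "n \<ge> 2"
    and "jordan_derivation (self_extension (matrix_ring TYPE('a) n)) \<Delta>"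
  shows "derivation (self_extension (matrix_ring TYPE('a) n)) \<Delta>"
proof -
  let ?T = "self_extension (matrix_ring TYPE('a) n)"
  let ?E = "\<lambda>i j. (matrix_unit n i j :: 'a mat, 0\<^sub>m n n :: 'a mat)"
  interpret T: ring ?T
    by (intro ring_self_extension ring_matrix_ring)
  have carrier: "carrier ?T = carrier_mat n n \<times> carrier_mat n n"
    and zero: "\<zero>\<^bsub>?T\<^esub> = (0\<^sub>m n n, 0\<^sub>m n n)"
    and add: "(A, A') \<oplus>\<^bsub>?T\<^esub> (B, B') = (A + B, A' + B')"
    and mult: "(A, A') \<otimes>\<^bsub>?T\<^esub> (B, B') = (A * B, A * B' + A' * B)" for A A' B B' :: "'a mat"
    by (simp_all add: trivial_extension_def matrix_ring_def)
  have n: "0 < n" "1 < n"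
    using \<open>n \<ge> 2\<close> by auto
  have mult_zero: "A * 0\<^sub>m n n = 0\<^sub>m n n" "0\<^sub>m n n * A = 0\<^sub>m n n" if "A \<in> carrier_mat n n" for A :: "'a mat"
    using that by (auto intro!: eq_matI simp: scalar_prod_def)
  have mult_E: "(B, B') \<otimes>\<^bsub>?T\<^esub> ?E i j = (B * matrix_unit n i j, B' * matrix_unit n i j)"
    if "B \<in> carrier_mat n n" "B' \<in> carrier_mat n n" for B B' i j
    using that by (auto simp: mult mult_zero intro!: left_add_zero_mat mult_carrier_mat)
  have E_mult: "?E i j \<otimes>\<^bsub>?T\<^esub> ?E k l = (if j = k then ?E i l else \<zero>\<^bsub>?T\<^esub>)"
    if "i < n" "j < n" "k < n" "l < n" for i j k l
    using that by (simp add: mult_E matrix_unit_mult mult_zero zero)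
  show ?thesis
  proof (rule T.jordan_derivation_imp_derivation[where e = "?E 0 0" and x = "?E 0 1" and y = "?E 1 0"])
    fix x
    assume x: "x \<in> carrier ?T" "x \<oplus>\<^bsub>?T\<^esub> x = \<zero>\<^bsub>?T\<^esub>"
    have "A = 0\<^sub>m n n" if "A \<in> carrier_mat n n" "A + A = 0\<^sub>m n n" for A :: "'a mat"
    proof (intro eq_matI)
      fix i j
      assume "i < dim_row (0\<^sub>m n n :: 'a mat)" "j < dim_col (0\<^sub>m n n :: 'a mat)"
      then have "A $$ (i, j) + A $$ (i, j) = 0"
        using that(1) arg_cong[OF that(2), of "\<lambda>B. B $$ (i, j)"] by simp
      then show "A $$ (i, j) = 0\<^sub>m n n $$ (i, j)"
        using two_torsion_free[of "A $$ (i, j)"] \<open>i < _\<close> \<open>j < _\<close> by simp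
    qed (use that in auto)
    from this[of "fst x"] this[of "snd x"] show "x = \<zero>\<^bsub>?T\<^esub>"
      using x by (cases x) (simp add: carrier zero add)
  next
    fix b
    assume b: "b \<in> carrier ?T"
      and ann: "\<And>z. z \<in> carrier ?T \<Longrightarrow> b \<otimes>\<^bsub>?T\<^esub> z \<otimes>\<^bsub>?T\<^esub> ?E 0 0 = \<zero>\<^bsub>?T\<^esub>"
    obtain B B' where B: "b = (B, B')" "B \<in> carrier_mat n n" "B' \<in> carrier_mat n n"
      using b by (auto simp: carrier)
    \<comment> \<open>right multiplication by \<open>E\<^sub>i\<^sub>0\<close> moves column \<open>i\<close> to column 0\<close>
    have column: "A $$ (k, i) = 0"
      if "A * matrix_unit n i 0 = 0\<^sub>m n n" "A \<in> carrier_mat n n" "i < n" "k < n" for A :: "'a mat" and i k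
      using that n mult_matrix_unit_index[of A n i k 0 0] by simp
    have "b \<otimes>\<^bsub>?T\<^esub> ?E i 0 = \<zero>\<^bsub>?T\<^esub>" if "i < n" for i
      using ann[of "?E i 0"] b that n by (simp add: T.m_assoc carrier E_mult)
    then have "B * matrix_unit n i 0 = 0\<^sub>m n n" "B' * matrix_unit n i 0 = 0\<^sub>m n n" if "i < n" for i
      using that B by (auto simp: mult_E zero)
    then have "B = 0\<^sub>m n n" "B' = 0\<^sub>m n n"
      using B(2,3) column by (auto intro!: eq_matI)
    then show "b = \<zero>\<^bsub>?T\<^esub>"
      by (simp add: zero B(1))
  qed (use n assms(3) in \<open>simp_all add: E_mult, simp_all add: carrier\<close>)
qed

end
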